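(* Let $A_1\in\mathbb{R}^{n\times n}$ with the splitting $A_1=(M_1+I-L_1)-(N_1+I-L_1)$. Let $z=\tau(|s|+s)$, $\omega=\Omega_1(|s|-s)$, and let the matrix $M_1+\Omega_1+I-L_1$ be nonsingular. Then the equivalent formulation of LCP$(q,A_1)$ in the form of a fixed point equation is $$s=(M_1+\Omega_1+I-L_1)^{-1}\big[(N_1+I-L_1)s+(\Omega_1-A_1)|s|-rq\big].$$
   Context: For $A_1\in\mathbb{R}^{n\times n}$ and $q\in\mathbb{R}^n$, LCP$(q,A_1)$ is the linear complementarity problem: find $z\in\mathbb{R}^n$ with $z\ge 0$, $A_1z+q\ge 0$ and $z^T(A_1z+q)=0$ (inequalities entrywise). The vector $\omega$ stands for $A_1z+q$. Here $s\in\mathbb{R}^n$, and $|s|$ is the entrywise absolute value of $s$. $M_1,N_1\in\mathbb{R}^{n\times n}$ satisfy $A_1=M_1-N_1$, $I$ is the identity matrix of order $n$, and $L_1$ is the strictly lower triangular matrix of $A_1$, with the convention $A_1=D_1-L_1-U_1$ ($D_1$ diagonal, $L_1$ strictly lower triangular, $U_1$ strictly upper triangular). $\Omega_1\in\mathbb{R}^{n\times n}$ is a positive diagonal matrix (diagonal with positive diagonal entries), $r>0$ is a scalar, and the scalar $\tau$ is related to $r$ by $\tau=\frac1r$.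
   Formalization: The reading ω = A₁z+q with ω = Ω₁(|s|−s), z = τ(|s|+s), τ = 1/r is inconsistent with the displayed equation unless r = 1; the formal statement instead uses A₁z+q = τω, keeping the substitution for z and the fixed point equation as displayed. *)

theory Defs
  imports "HOL-Analysis.Analysis"
begin

text \<open>On \<open>real ^ 'n\<close> the library's \<open>\<le>\<close> and \<open>\<bar>_\<bar>\<close> are entrywise.\<close>

definition lcp_solution :: "real ^ 'n \<Rightarrow> real ^ 'n ^ 'n \<Rightarrow> real ^ 'n \<Rightarrow> bool" where
  "lcp_solution q A z \<longleftrightarrow> 0 \<le> z \<and> 0 \<le> A *v z + q \<and> z \<bullet> (A *v z + q) = 0"

definition diagonal_matrix :: "real ^ 'n ^ 'n \<Rightarrow> bool" where
  "diagonal_matrix A \<longleftrightarrow> (\<forall>i j. i \<noteq> j \<longrightarrow> A $ i $ j = 0)"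

definition positive_diagonal_matrix :: "real ^ 'n ^ 'n \<Rightarrow> bool" where
  "positive_diagonal_matrix A \<longleftrightarrow> diagonal_matrix A \<and> (\<forall>i. 0 < A $ i $ i)"

text \<open>Triangularity refers to the linear order on the index type.\<close>

definition strictly_lower_triangular :: "real ^ ('n :: {finite, linorder}) ^ ('n :: {finite, linorder}) \<Rightarrow> bool" where
  "strictly_lower_triangular A \<longleftrightarrow> (\<forall>i j. i \<le> j \<longrightarrow> A $ i $ j = 0)"

definition strictly_upper_triangular :: "real ^ ('n :: {finite, linorder}) ^ ('n :: {finite, linorder}) \<Rightarrow> bool" where
  "strictly_upper_triangular A \<longleftrightarrow> (\<forall>i j. j \<le> i \<longrightarrow> A $ i $ j = 0)"

end

theory Submission
  imports Defs
begin

text \<open>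
  A pair of numbers \<open>a, b \<ge> 0\<close> with \<open>a * b = 0\<close> is the same thing as a single real \<open>s\<close>:
  take \<open>a = \<bar>s\<bar> + s\<close> and \<open>b = \<bar>s\<bar> - s\<close>, that is, twice the positive and twice the negative part.
  The modulus substitution uses this in every coordinate, with positive weights: the
  scalar \<open>\<tau> = 1 / r\<close> on the part that represents \<open>z\<close>, and the diagonal entries of \<open>\<tau> \<Omega>\<close> on the
  part that represents the slack \<open>A z + q\<close>. All sign and complementarity conditions of the LCP
  then hold automatically (\<open>lcp_solution_of_modulus\<close>), every solution arises in this way
  (\<open>modulus_of_lcp_solution\<close>), and the only condition left is the linear relation
  \<open>A z + q = \<tau> \<Omega> (\<bar>s\<bar> - s)\<close>.

  Multiplying this relation by \<open>r\<close> and moving the terms that the splitting assigns to the left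
  gives a linear system for \<open>s\<close> whose matrix is nonsingular, so that it can be solved for the
  \<open>s\<close> on the left (\<open>modulus_equation_iff_fixed_point\<close>).
\<close>

lemma diagonal_matrix_vector_mult_nth:
  assumes "diagonal_matrix D"
  shows "(D *v x) $ i = D $ i $ i * x $ i"
proof -
  have "(D *v x) $ i = (\<Sum>j\<in>UNIV. D $ i $ j * x $ j)"
    by (simp add: matrix_vector_mult_def)
  also have "\<dots> = (\<Sum>j\<in>UNIV. if j = i then D $ i $ i * x $ i else 0)"
    using assms by (intro sum.cong) (auto simp: diagonal_matrix_def)
  finally show ?thesis by simp
qed

lemma eq_matrix_inv_mult_iff:
  fixes P :: "real ^ 'n ^ 'n"
  assumes "invertible P"
  shows "x = matrix_inv P *v y \<longleftrightarrow> P *v x = y"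
proof -
  have "P ** matrix_inv P = mat 1 \<and> matrix_inv P ** P = mat 1"
    using assms unfolding invertible_def matrix_inv_def by (rule someI_ex)
  then show ?thesis
    by (metis matrix_vector_mul_assoc matrix_vector_mul_lid)
qed

text \<open>
  A sum of nonnegative terms vanishes only if every term does, so the scalar condition
  \<open>z\<^sup>T w = 0\<close> is complementarity in each coordinate.
\<close>

lemma lcp_solution_componentwise:
  "lcp_solution q A z \<longleftrightarrow>
    (\<forall>i. 0 \<le> z $ i \<and> 0 \<le> (A *v z + q) $ i \<and> z $ i * (A *v z + q) $ i = 0)"
proof -
  have "z \<bullet> w = 0 \<longleftrightarrow> (\<forall>i. z $ i * w $ i = 0)" if "0 \<le> z" "0 \<le> w" for w :: "real ^ 'a"
    using that by (simp add: inner_vec_def less_eq_vec_def sum_nonneg_eq_0_iff)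
  then show ?thesis
    unfolding lcp_solution_def by (auto simp: less_eq_vec_def)
qed

lemma lcp_solution_of_modulus:
  assumes "positive_diagonal_matrix \<Omega>" and "\<tau> > 0"
    and z: "z = \<tau> *\<^sub>R (\<bar>s\<bar> + s)" and w: "A *v z + q = \<tau> *\<^sub>R (\<Omega> *v (\<bar>s\<bar> - s))"
  shows "lcp_solution q A z"
proof -
  have zi: "z $ i = \<tau> * (\<bar>s $ i\<bar> + s $ i)" for i
    by (simp add: z abs_vec_def)
  have wi: "(A *v z + q) $ i = \<tau> * (\<Omega> $ i $ i * (\<bar>s $ i\<bar> - s $ i))" for i
    using assms(1) unfolding w positive_diagonal_matrix_def
    by (simp add: diagonal_matrix_vector_mult_nth abs_vec_def)
  have "0 < \<Omega> $ i $ i" for i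
    using assms(1) by (simp add: positive_diagonal_matrix_def)
  then show ?thesis
    unfolding lcp_solution_componentwise zi wi
    using \<open>\<tau> > 0\<close> by (auto simp: abs_if less_imp_le mult_pos_neg mult_neg_pos)
qed

text \<open>
  Solving \<open>z\<^sub>i = \<tau> (\<bar>s\<^sub>i\<bar> + s\<^sub>i)\<close> and \<open>w\<^sub>i = \<tau> \<Omega>\<^sub>i\<^sub>i (\<bar>s\<^sub>i\<bar> - s\<^sub>i)\<close> for \<open>s\<^sub>i\<close> forces
  \<open>s\<^sub>i = (z\<^sub>i - w\<^sub>i / \<Omega>\<^sub>i\<^sub>i) / (2 \<tau>)\<close>. Since one of \<open>z\<^sub>i, w\<^sub>i\<close> is zero, the modulus of this number is
  the same expression with a plus sign, and so the choice does satisfy both equations.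
\<close>

lemma modulus_of_lcp_solution:
  assumes "positive_diagonal_matrix \<Omega>" and "\<tau> > 0" and "lcp_solution q A z"
  obtains s where "z = \<tau> *\<^sub>R (\<bar>s\<bar> + s)" and "A *v z + q = \<tau> *\<^sub>R (\<Omega> *v (\<bar>s\<bar> - s))"
proof -
  define w where "w = A *v z + q"
  define s where "s = (\<chi> i. (z $ i - w $ i / \<Omega> $ i $ i) / (2 * \<tau>))"
  have pos: "0 < \<Omega> $ i $ i" for i
    using assms(1) by (simp add: positive_diagonal_matrix_def)
  have compl: "0 \<le> z $ i" "0 \<le> w $ i" "z $ i = 0 \<or> w $ i = 0" for i
    using assms(3) by (auto simp: lcp_solution_componentwise w_def)
  have abs_s: "\<bar>s $ i\<bar> = (z $ i + w $ i / \<Omega> $ i $ i) / (2 * \<tau>)" for i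
    using compl[of i] pos[of i] \<open>\<tau> > 0\<close> by (auto simp: s_def abs_mult)
  have "z = \<tau> *\<^sub>R (\<bar>s\<bar> + s)"
    using \<open>\<tau> > 0\<close>
    by (simp add: vec_eq_iff abs_vec_def abs_s) (simp add: s_def field_simps)
  moreover have "w = \<tau> *\<^sub>R (\<Omega> *v (\<bar>s\<bar> - s))"
  proof -
    have "(\<Omega> *v (\<bar>s\<bar> - s)) $ i = \<Omega> $ i $ i * (\<bar>s $ i\<bar> - s $ i)" for i
      using assms(1)
      by (simp add: positive_diagonal_matrix_def diagonal_matrix_vector_mult_nth abs_vec_def)
    moreover have "w $ i = \<tau> * (\<Omega> $ i $ i * (\<bar>s $ i\<bar> - s $ i))" for i
      using \<open>\<tau> > 0\<close> pos[of i] unfolding abs_s by (simp add: s_def field_simps)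
    ultimately show ?thesis
      by (simp add: vec_eq_iff)
  qed
  ultimately show thesis
    using that unfolding w_def by blast
qed

text \<open>
  The term \<open>K s\<close> stands on both sides of the linear system and cancels, so any matrix \<open>K\<close> that
  keeps \<open>M + \<Omega> + K\<close> nonsingular gives a fixed point form of the same equation; the choice of
  interest is \<open>K = I - L\<close>.
\<close>

lemma modulus_equation_iff_fixed_point:
  fixes M N \<Omega> K :: "real ^ 'n ^ 'n"
  assumes "A = M - N" and "r > 0" and "invertible (M + \<Omega> + K)"
  shows "A *v ((1 / r) *\<^sub>R (\<bar>s\<bar> + s)) + q = (1 / r) *\<^sub>R (\<Omega> *v (\<bar>s\<bar> - s)) \<longleftrightarrow>
    s = matrix_inv (M + \<Omega> + K) *v ((N + K) *v s + (\<Omega> - A) *v \<bar>s\<bar> - r *\<^sub>R q)"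
proof -
  have "A *v ((1 / r) *\<^sub>R (\<bar>s\<bar> + s)) + q = (1 / r) *\<^sub>R (A *v (\<bar>s\<bar> + s) + r *\<^sub>R q)"
    using \<open>r > 0\<close> by (simp add: matrix_vector_mult_scaleR scaleR_add_right[of _ _ "r *\<^sub>R q"]
        del: scaleR_add_right)
  then have "A *v ((1 / r) *\<^sub>R (\<bar>s\<bar> + s)) + q = (1 / r) *\<^sub>R (\<Omega> *v (\<bar>s\<bar> - s)) \<longleftrightarrow>
      A *v (\<bar>s\<bar> + s) + r *\<^sub>R q = \<Omega> *v (\<bar>s\<bar> - s)"
    using \<open>r > 0\<close> by simp
  also have "\<dots> \<longleftrightarrow> (M + \<Omega> + K) *v s = (N + K) *v s + (\<Omega> - A) *v \<bar>s\<bar> - r *\<^sub>R q"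
    unfolding assms(1)
    by (auto simp: matrix_vector_mult_add_rdistrib matrix_vector_mult_diff_rdistrib
        matrix_vector_right_distrib matrix_vector_mult_diff_distrib algebra_simps)
  also have "\<dots> \<longleftrightarrow>
      s = matrix_inv (M + \<Omega> + K) *v ((N + K) *v s + (\<Omega> - A) *v \<bar>s\<bar> - r *\<^sub>R q)"
    using eq_matrix_inv_mult_iff[OF assms(3)] by simp
  finally show ?thesis .
qed

theorem theorem3p1:
  fixes A\<^sub>1 M\<^sub>1 N\<^sub>1 D\<^sub>1 L\<^sub>1 U\<^sub>1 \<Omega>\<^sub>1 :: "real ^ ('n :: {finite, linorder}) ^ ('n :: {finite, linorder})"
    and q :: "real ^ ('n :: {finite, linorder})" and r \<tau> :: real
  assumes "A\<^sub>1 = M\<^sub>1 - N\<^sub>1"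
    and "A\<^sub>1 = (M\<^sub>1 + mat 1 - L\<^sub>1) - (N\<^sub>1 + mat 1 - L\<^sub>1)"
    and "A\<^sub>1 = D\<^sub>1 - L\<^sub>1 - U\<^sub>1"
    and "diagonal_matrix D\<^sub>1"
    and "strictly_lower_triangular L\<^sub>1"
    and "strictly_upper_triangular U\<^sub>1"
    and "positive_diagonal_matrix \<Omega>\<^sub>1"
    and "r > 0" and "\<tau> = 1 / r"
    and "invertible (M\<^sub>1 + \<Omega>\<^sub>1 + mat 1 - L\<^sub>1)"
  shows "(\<forall>z. lcp_solution q A\<^sub>1 z \<longleftrightarrow>
            (\<exists>s. z = \<tau> *\<^sub>R (\<bar>s\<bar> + s) \<and>
                 s = matrix_inv (M\<^sub>1 + \<Omega>\<^sub>1 + mat 1 - L\<^sub>1) *v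
                       ((N\<^sub>1 + mat 1 - L\<^sub>1) *v s + (\<Omega>\<^sub>1 - A\<^sub>1) *v \<bar>s\<bar> - r *\<^sub>R q))) \<and>
         (\<forall>s z \<omega>. z = \<tau> *\<^sub>R (\<bar>s\<bar> + s) \<longrightarrow> \<omega> = \<Omega>\<^sub>1 *v (\<bar>s\<bar> - s) \<longrightarrow>
            (lcp_solution q A\<^sub>1 z \<and> A\<^sub>1 *v z + q = \<tau> *\<^sub>R \<omega> \<longleftrightarrow>
             s = matrix_inv (M\<^sub>1 + \<Omega>\<^sub>1 + mat 1 - L\<^sub>1) *v
                   ((N\<^sub>1 + mat 1 - L\<^sub>1) *v s + (\<Omega>\<^sub>1 - A\<^sub>1) *v \<bar>s\<bar> - r *\<^sub>R q)))"
proof -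
  have \<tau>: "\<tau> > 0"
    using assms(8,9) by simp
  have fixed_point: "A\<^sub>1 *v (\<tau> *\<^sub>R (\<bar>s\<bar> + s)) + q = \<tau> *\<^sub>R (\<Omega>\<^sub>1 *v (\<bar>s\<bar> - s)) \<longleftrightarrow>
      s = matrix_inv (M\<^sub>1 + \<Omega>\<^sub>1 + mat 1 - L\<^sub>1) *v
            ((N\<^sub>1 + mat 1 - L\<^sub>1) *v s + (\<Omega>\<^sub>1 - A\<^sub>1) *v \<bar>s\<bar> - r *\<^sub>R q)" for s
    using modulus_equation_iff_fixed_point[of A\<^sub>1 M\<^sub>1 N\<^sub>1 r \<Omega>\<^sub>1 "mat 1 - L\<^sub>1" s q] assms(1,8,9,10)
    by (simp only: add_diff_eq simp_thms)
  show ?thesis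
    unfolding fixed_point[symmetric]
    using lcp_solution_of_modulus[OF assms(7) \<tau>] modulus_of_lcp_solution[OF assms(7) \<tau>]
    by (intro conjI allI iffI impI) (blast | metis)+
qed

end
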